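(* Let $Y$ be a rectifiable space and $X$ be a topological space. If the set $X'$ of non-isolated points of $X$ is a retract of $X$, then the function space $C_k(X,Y)$ is homeomorphic to $C_k(X',Y)\times C_k'(X,Y)$.
   Context: A point $x\in X$ is isolated if $\{x\}$ is clopen in $X$; $X'$ is the set of non-isolated points of $X$. $X'$ is a retract of $X$ if there is a continuous map $r:X\to X'$ with $r(a)=a$ for all $a\in X'$. A pointed space $Y$ (a topological space with a distinguished point $*_Y$) is rectifiable if there exists a homeomorphism $H:Y\times Y\to Y\times Y$ such that $H(\{y\}\times Y)=\{y\}\times Y$ and $H(y,y)=(y,*_Y)$ for every $y\in Y$. $C_k(X,Y)$ is the space of continuous functions $X\to Y$ with the compact-open topology, and $C_k'(X,Y)=\{f\in C_k(X,Y):f(X')\subset\{*_Y\}\}$ with the subspace topology. *)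

theory Defs
  imports "HOL-Analysis.Analysis"
begin

(* Isolated means that {x} is clopen. In spaces that are not T1 this is stronger than {x} being
   open, so in general this set is larger than the derived set X derived_set_of topspace X. *)
definition isolated_points :: "'a topology \<Rightarrow> 'a set" where
  "isolated_points X = {x \<in> topspace X. openin X {x} \<and> closedin X {x}}"

definition nonisolated_points :: "'a topology \<Rightarrow> 'a set" where
  "nonisolated_points X = topspace X - isolated_points X"

(* The pair (Y, e) is a pointed space with distinguished point e. *)
definition rectifiable_space :: "'b topology \<Rightarrow> 'b \<Rightarrow> bool" where
  "rectifiable_space Y e \<longleftrightarrow>
     e \<in> topspace Y \<and>
     (\<exists>H. homeomorphic_map (prod_topology Y Y) (prod_topology Y Y) H \<and>
          (\<forall>y \<in> topspace Y. H ` ({y} \<times> topspace Y) = {y} \<times> topspace Y \<and> H (y, y) = (y, e)))"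

(* A continuous map X -> Y is represented by the function on the whole type that is undefined
   outside topspace X, so that equal maps are equal functions. *)
definition continuous_maps :: "'a topology \<Rightarrow> 'b topology \<Rightarrow> ('a \<Rightarrow> 'b) set" where
  "continuous_maps X Y = {f \<in> extensional (topspace X). continuous_map X Y f}"

definition Ck_space :: "'a topology \<Rightarrow> 'b topology \<Rightarrow> ('a \<Rightarrow> 'b) topology" where
  "Ck_space X Y =
     topology_generated_by
       {{f \<in> continuous_maps X Y. f ` K \<subseteq> U} |K U. compactin X K \<and> openin Y U}"

lemma topspace_Ck_space [simp]: "topspace (Ck_space X Y) = continuous_maps X Y"
proof -
  have "continuous_maps X Y = {f \<in> continuous_maps X Y. f ` {} \<subseteq> topspace Y}"
    by simp
  then have "continuous_maps X Y \<in>
      {{f \<in> continuous_maps X Y. f ` K \<subseteq> U} |K U. compactin X K \<and> openin Y U}"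
    using compactin_empty openin_topspace by blast
  then show ?thesis
    unfolding Ck_space_def topology_generated_by_topspace by blast
qed

definition Ck'_space :: "'a topology \<Rightarrow> 'b topology \<Rightarrow> 'b \<Rightarrow> ('a \<Rightarrow> 'b) topology" where
  "Ck'_space X Y e =
     subtopology (Ck_space X Y) {f \<in> continuous_maps X Y. f ` nonisolated_points X \<subseteq> {e}}"

end

(* Write a homeomorphism H witnessing rectifiability as H (x, y) = (x, p (x, y)), with inverse
   (x, y) |-> (x, q (x, y)).  For a retraction r onto A, the set of non-isolated points, the map
   f |-> (f|A, p (f o r, f)) is the required homeomorphism, with inverse (g, h) |-> q (g o r, h):
   indeed p (x, x) = e and q (x, e) = x.

   Since X is arbitrary, continuity of (f, g) |-> phi o (f, g) in the compact-open topology rests on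
   regularity of the target, which lets one cut a compact set into compact pieces on which f and g
   each stay in prescribed open sets.  Rectifiable spaces are regular, without separation axioms. *)

theory Submission
  imports Defs
begin

section \<open>Rectifiable spaces: division maps and regularity\<close>

lemma rectifiable_spaceE:
  assumes "rectifiable_space Y e"
  obtains p q where
    "continuous_map (prod_topology Y Y) Y p"
    "continuous_map (prod_topology Y Y) Y q"
    "\<forall>x \<in> topspace Y. \<forall>y \<in> topspace Y. q (x, p (x, y)) = y"
    "\<forall>x \<in> topspace Y. \<forall>y \<in> topspace Y. p (x, q (x, y)) = y"
    "\<forall>x \<in> topspace Y. p (x, x) = e"
    "\<forall>x \<in> topspace Y. q (x, e) = x"
proof -
  let ?YY = "prod_topology Y Y"
  obtain H where "homeomorphic_map ?YY ?YY H"
    and im: "\<And>y. y \<in> topspace Y \<Longrightarrow> H ` ({y} \<times> topspace Y) = {y} \<times> topspace Y"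
    and diag: "\<And>y. y \<in> topspace Y \<Longrightarrow> H (y, y) = (y, e)"
    using assms unfolding rectifiable_space_def by blast
  then obtain H' where H': "homeomorphic_maps ?YY ?YY H H'"
    by (auto simp: homeomorphic_map_maps)
  have HH': "H (H' z) = z" and H'H: "H' (H z) = z" if "z \<in> topspace Y \<times> topspace Y" for z
    using H' that by (auto simp: homeomorphic_maps_def)
  have fst_H: "fst (H (x, y)) = x" if "x \<in> topspace Y" "y \<in> topspace Y" for x y
  proof -
    have "H (x, y) \<in> H ` ({x} \<times> topspace Y)"
      using that by (intro imageI) simp
    then show ?thesis
      unfolding im[OF that(1)] by (simp add: mem_Times_iff)
  qed
  \<comment> \<open>The inverse respects fibres because \<open>H\<close> maps each fibre onto
    itself, not merely into itself: the preimage of \<open>(x, y)\<close> found in the fibre over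
    \<open>x\<close> must be \<open>H' (x, y)\<close>.\<close>
  have fst_H': "fst (H' (x, y)) = x" if xy: "x \<in> topspace Y" "y \<in> topspace Y" for x y
  proof -
    have "(x, y) \<in> H ` ({x} \<times> topspace Y)"
      unfolding im[OF xy(1)] using xy by simp
    then obtain z where z: "z \<in> topspace Y" "(x, y) = H (x, z)"
      by auto
    then show ?thesis
      using H'H[of "(x, z)"] xy(1) unfolding z(2) by simp
  qed
  let ?p = "snd \<circ> H" and ?q = "snd \<circ> H'"
  have qp: "?q (x, ?p (x, y)) = y" if "x \<in> topspace Y" "y \<in> topspace Y" for x y
  proof -
    have "(x, snd (H (x, y))) = H (x, y)"
      using fst_H[OF that] by (metis prod.collapse)
    then show ?thesis
      using H'H that by simp
  qed
  have pq: "?p (x, ?q (x, y)) = y" if "x \<in> topspace Y" "y \<in> topspace Y" for x y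
  proof -
    have "(x, snd (H' (x, y))) = H' (x, y)"
      using fst_H'[OF that] by (metis prod.collapse)
    then show ?thesis
      using HH' that by simp
  qed
  have p_diag: "?p (x, x) = e" if "x \<in> topspace Y" for x
    using diag that by simp
  have q_diag: "?q (x, e) = x" if "x \<in> topspace Y" for x
    using qp[OF that that] p_diag[OF that] by simp
  have cont: "continuous_map ?YY Y ?p" "continuous_map ?YY Y ?q"
    using H' by (auto simp: homeomorphic_maps_def intro: continuous_map_compose continuous_map_snd)
  show thesis
    by (rule that[OF cont]) (use qp pq p_diag q_diag in blast)+
qed

text \<open>Since \<open>q (x, e) = x\<close>, continuity of \<open>q\<close> gives neighbourhoods
  \<open>V\<close> of \<open>x\<close> and \<open>W\<close> of \<open>e\<close> with
  \<open>q\<close> mapping \<open>V \<times> W\<close> off \<open>C\<close>. If \<open>y\<close>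
  lies in the closure of \<open>V\<close>, then \<open>p (y, y) = e\<close> and continuity of
  \<open>p\<close> in its first argument yield \<open>z\<close> in \<open>V\<close> with
  \<open>p (z, y)\<close> in \<open>W\<close>. Hence \<open>y = q (z, p (z, y))\<close> is not in
  \<open>C\<close>.\<close>

lemma rectifiable_imp_regular_space:
  assumes "rectifiable_space Y e"
  shows "regular_space Y"
  unfolding regular_space
proof (intro allI impI, elim conjE)
  fix C x
  assume C: "closedin Y C" and x: "x \<in> topspace Y - C"
  obtain p q where p: "continuous_map (prod_topology Y Y) Y p"
    and q: "continuous_map (prod_topology Y Y) Y q"
    and qp: "\<forall>x \<in> topspace Y. \<forall>y \<in> topspace Y. q (x, p (x, y)) = y"
    and "\<forall>x \<in> topspace Y. \<forall>y \<in> topspace Y. p (x, q (x, y)) = y"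
    and pe: "\<forall>x \<in> topspace Y. p (x, x) = e"
    and qe: "\<forall>x \<in> topspace Y. q (x, e) = x"
    using rectifiable_spaceE[OF assms] .
  have e: "e \<in> topspace Y"
    using assms by (simp add: rectifiable_space_def)
  have "openin (prod_topology Y Y) {z \<in> topspace (prod_topology Y Y). q z \<in> topspace Y - C}"
    using q C by (intro openin_continuous_map_preimage) auto
  moreover have "(x, e) \<in> {z \<in> topspace (prod_topology Y Y). q z \<in> topspace Y - C}"
    using x e qe by auto
  ultimately obtain V W where VW: "openin Y V" "openin Y W" "x \<in> V" "e \<in> W"
    and sub: "V \<times> W \<subseteq> {z \<in> topspace (prod_topology Y Y). q z \<in> topspace Y - C}"
    unfolding openin_prod_topology_alt by meson
  have "y \<notin> C" if y: "y \<in> Y closure_of V" for y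
  proof -
    have yY: "y \<in> topspace Y"
      using y by (simp add: in_closure_of)
    have "continuous_map Y Y (\<lambda>z. p (z, y))"
      using continuous_map_compose[OF _ p, of Y "\<lambda>z. (z, y)"] yY
      by (simp add: o_def continuous_map_pairedI)
    then have "openin Y {z \<in> topspace Y. p (z, y) \<in> W}"
      using VW by (intro openin_continuous_map_preimage)
    then obtain z where "z \<in> V" "z \<in> topspace Y" "p (z, y) \<in> W"
      using y yY pe VW(4) unfolding in_closure_of mem_Collect_eq
      by (metis (mono_tags, lifting) mem_Collect_eq)
    then have "q (z, p (z, y)) \<notin> C"
      using sub by blast
    then show ?thesis
      using qp \<open>z \<in> topspace Y\<close> yY by simp
  qed
  then show "\<exists>V. openin Y V \<and> x \<in> V \<and> disjnt C (Y closure_of V)"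
    using VW by (auto simp: disjnt_iff)
qed

section \<open>Continuity into the compact-open topology and precomposition\<close>

lemma continuous_mapsD:
  assumes "f \<in> continuous_maps X Y"
  shows "continuous_map X Y f" "f \<in> extensional (topspace X)"
  using assms by (auto simp: continuous_maps_def)

lemma restrict_in_continuous_maps:
  assumes "continuous_map X Y f"
  shows "restrict f (topspace X) \<in> continuous_maps X Y"
  using assms by (auto simp: continuous_maps_def intro: continuous_map_eq)

lemma openin_Ck_space:
  assumes "compactin X K" "openin Y U"
  shows "openin (Ck_space X Y) {f \<in> continuous_maps X Y. f ` K \<subseteq> U}"
  unfolding Ck_space_def using assms by (intro topology_generated_by_Basis) blast

lemma continuous_map_into_Ck_space:
  assumes "\<And>s. s \<in> topspace S \<Longrightarrow> F s \<in> continuous_maps X Y"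
    and "\<And>K U. \<lbrakk>compactin X K; openin Y U\<rbrakk> \<Longrightarrow> openin S {s \<in> topspace S. F s ` K \<subseteq> U}"
  shows "continuous_map S (Ck_space X Y) F"
  unfolding Ck_space_def
proof (rule continuous_on_generated_topo)
  fix N
  assume "N \<in> {{f \<in> continuous_maps X Y. f ` K \<subseteq> U} |K U. compactin X K \<and> openin Y U}"
  then obtain K U where "compactin X K" "openin Y U"
    and N: "N = {f \<in> continuous_maps X Y. f ` K \<subseteq> U}"
    by blast
  moreover have "F -` N \<inter> topspace S = {s \<in> topspace S. F s ` K \<subseteq> U}"
    using assms(1) unfolding N by blast
  ultimately show "openin S (F -` N \<inter> topspace S)"
    using assms(2) by simp
next
  \<comment> \<open>The union of the subbasis is the whole set of continuous maps, since the empty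
    compact set imposes no condition.\<close>
  show "F ` topspace S \<subseteq> \<Union> {{f \<in> continuous_maps X Y. f ` K \<subseteq> U} |K U. compactin X K \<and> openin Y U}"
    using assms(1) topspace_Ck_space[of X Y] unfolding Ck_space_def topology_generated_by_topspace
    by blast
qed

lemma continuous_map_Ck_space_preimage:
  assumes F: "continuous_map S (Ck_space X Y) F" and "compactin X K" "openin Y U"
  shows "openin S {s \<in> topspace S. F s ` K \<subseteq> U}"
proof -
  have "F s \<in> continuous_maps X Y" if "s \<in> topspace S" for s
    using F that by (auto simp: continuous_map_def)
  then have "{s \<in> topspace S. F s ` K \<subseteq> U} =
      {s \<in> topspace S. F s \<in> {f \<in> continuous_maps X Y. f ` K \<subseteq> U}}"
    by blast
  then show ?thesis
    using openin_continuous_map_preimage[OF F openin_Ck_space] assms by simp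
qed

lemma continuous_map_into_continuous_maps:
  assumes "continuous_map S (Ck_space X Y) F" "s \<in> topspace S"
  shows "F s \<in> continuous_maps X Y"
  using assms by (auto simp: continuous_map_def)

lemma continuous_map_Ck_space_imp_continuous_map:
  assumes "continuous_map S (Ck_space X Y) F" "s \<in> topspace S"
  shows "continuous_map X Y (F s)"
  using continuous_mapsD(1)[OF continuous_map_into_continuous_maps[OF assms]] .

lemma continuous_map_Ck_space_precompose:
  assumes F: "continuous_map S (Ck_space X Y) F" and r: "continuous_map Z X r"
  shows "continuous_map S (Ck_space Z Y) (\<lambda>s. \<lambda>z \<in> topspace Z. F s (r z))"
proof (rule continuous_map_into_Ck_space)
  fix s assume "s \<in> topspace S"
  then have "continuous_map X Y (F s)"
    by (rule continuous_map_Ck_space_imp_continuous_map[OF F])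
  then have "continuous_map Z Y (\<lambda>z. F s (r z))"
    using continuous_map_compose[OF r] by (simp add: o_def)
  then show "(\<lambda>z \<in> topspace Z. F s (r z)) \<in> continuous_maps Z Y"
    by (rule restrict_in_continuous_maps)
next
  fix K U assume K: "compactin Z K" and U: "openin Y U"
  have "(\<lambda>z \<in> topspace Z. F s (r z)) ` K = F s ` r ` K" for s
    using compactin_subset_topspace[OF K] by (auto simp: image_iff subset_iff)
  then show "openin S {s \<in> topspace S. (\<lambda>z \<in> topspace Z. F s (r z)) ` K \<subseteq> U}"
    using continuous_map_Ck_space_preimage[OF F image_compactin[OF K r] U] by simp
qed

section \<open>Regularity and pointwise application of a binary map\<close>

lemma regular_spaceE:
  assumes "regular_space X" "openin X W" "x \<in> W"
  obtains U C where "openin X U" "closedin X C" "x \<in> U" "U \<subseteq> C" "C \<subseteq> W"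
  using assms unfolding neighbourhood_base_of_closedin[symmetric] neighbourhood_base_of by meson

text \<open>Each layer has its own use below: the open sets \<open>A\<close>, \<open>B\<close> give
  neighbourhoods in the source, the closed sets \<open>C\<close>, \<open>D\<close> cut out a compact
  piece, and the open sets \<open>U\<close>, \<open>V\<close> are the targets of subbasic
  conditions.\<close>

lemma regular_space_prod_nbhdE:
  assumes "regular_space Y" "regular_space Z"
    and "openin (prod_topology Y Z) W" "(y, z) \<in> W"
  obtains A B C D U V where "openin Y A" "closedin Y C" "openin Y U" "y \<in> A" "A \<subseteq> C" "C \<subseteq> U"
    "openin Z B" "closedin Z D" "openin Z V" "z \<in> B" "B \<subseteq> D" "D \<subseteq> V" "U \<times> V \<subseteq> W"
proof -
  obtain U V where UV: "openin Y U" "openin Z V" "y \<in> U" "z \<in> V" "U \<times> V \<subseteq> W"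
    using assms(3,4) unfolding openin_prod_topology_alt by meson
  obtain A C where "openin Y A" "closedin Y C" "y \<in> A" "A \<subseteq> C" "C \<subseteq> U"
    using regular_spaceE[OF assms(1) UV(1,3)] .
  moreover obtain B D where "openin Z B" "closedin Z D" "z \<in> B" "B \<subseteq> D" "D \<subseteq> V"
    using regular_spaceE[OF assms(2) UV(2,4)] .
  ultimately show thesis
    using that UV by blast
qed

lemma continuous_map_Ck_space_postcompose2:
  assumes Y: "regular_space Y" and Z: "regular_space Z"
    and phi: "continuous_map (prod_topology Y Z) T \<phi>"
    and F: "continuous_map S (Ck_space X Y) F" and G: "continuous_map S (Ck_space X Z) G"
  shows "continuous_map S (Ck_space X T) (\<lambda>s. \<lambda>x \<in> topspace X. \<phi> (F s x, G s x))"
proof (rule continuous_map_into_Ck_space)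
  fix s assume "s \<in> topspace S"
  then have "continuous_map X Y (F s)" "continuous_map X Z (G s)"
    using F G by (auto intro: continuous_map_Ck_space_imp_continuous_map)
  then have "continuous_map X (prod_topology Y Z) (\<lambda>x. (F s x, G s x))"
    by (rule continuous_map_pairedI)
  then have "continuous_map X T (\<lambda>x. \<phi> (F s x, G s x))"
    using continuous_map_compose[OF _ phi, of X "\<lambda>x. (F s x, G s x)"] by (simp add: o_def)
  then show "(\<lambda>x \<in> topspace X. \<phi> (F s x, G s x)) \<in> continuous_maps X T"
    by (rule restrict_in_continuous_maps)
next
  fix K O' assume K: "compactin X K" and O': "openin T O'"
  have KX: "K \<subseteq> topspace X"
    using K by (rule compactin_subset_topspace)
  define W where "W = {w \<in> topspace (prod_topology Y Z). \<phi> w \<in> O'}"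
  have W: "openin (prod_topology Y Z) W"
    unfolding W_def using phi O' by (rule openin_continuous_map_preimage)
  let ?P = "{s \<in> topspace S. (\<lambda>x \<in> topspace X. \<phi> (F s x, G s x)) ` K \<subseteq> O'}"
  have "\<exists>N. openin S N \<and> s \<in> N \<and> N \<subseteq> ?P" if s: "s \<in> ?P" for s
  proof -
    have sS: "s \<in> topspace S"
      using s by simp
    have f: "continuous_map X Y (F s)" and g: "continuous_map X Z (G s)"
      using F G sS by (auto intro: continuous_map_Ck_space_imp_continuous_map)
    have "\<exists>M N. openin X M \<and> x \<in> M \<and> openin S N \<and> s \<in> N \<and>
        (\<forall>t \<in> N. \<forall>y \<in> M \<inter> K. \<phi> (F t y, G t y) \<in> O')" if x: "x \<in> K" for x
    proof -
      have "(F s x, G s x) \<in> W"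
        using x s KX f g by (auto simp: W_def continuous_map_def Pi_iff image_subset_iff)
      then obtain A B C D U V where
        YA: "openin Y A" "closedin Y C" "openin Y U" "F s x \<in> A" "A \<subseteq> C" "C \<subseteq> U" and
        ZB: "openin Z B" "closedin Z D" "openin Z V" "G s x \<in> B" "B \<subseteq> D" "D \<subseteq> V" and
        UV: "U \<times> V \<subseteq> W"
        by (rule regular_space_prod_nbhdE[OF Y Z W])
      let ?M = "{y \<in> topspace X. F s y \<in> A} \<inter> {y \<in> topspace X. G s y \<in> B}"
      \<comment> \<open>A closed set meets \<open>K\<close> in a compact set, with no separation
        axiom on \<open>X\<close>. This piece contains \<open>?M \<inter> K\<close>, and
        \<open>F s\<close>, \<open>G s\<close> map it into \<open>C \<subseteq> U\<close> and
        \<open>D \<subseteq> V\<close>, so \<open>s\<close> itself satisfies the conditions defining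
        \<open>?N\<close>.\<close>
      let ?L = "({y \<in> topspace X. F s y \<in> C} \<inter> {y \<in> topspace X. G s y \<in> D}) \<inter> K"
      let ?N = "{t \<in> topspace S. F t ` ?L \<subseteq> U} \<inter> {t \<in> topspace S. G t ` ?L \<subseteq> V}"
      have "openin X ?M"
        using YA(1) ZB(1) f g by (intro openin_Int openin_continuous_map_preimage)
      moreover have "x \<in> ?M"
        using x KX YA(4) ZB(4) by blast
      moreover have "compactin X ?L"
        using YA(2) ZB(2) f g K
        by (intro closed_Int_compactin closedin_Int closedin_continuous_map_preimage)
      then have "openin S ?N"
        using YA(3) ZB(3) by (intro openin_Int continuous_map_Ck_space_preimage[OF F]
            continuous_map_Ck_space_preimage[OF G])
      moreover have "s \<in> ?N"
        using sS YA(6) ZB(6) by blast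
      moreover have "\<phi> (F t y, G t y) \<in> O'" if t: "t \<in> ?N" and y: "y \<in> ?M \<inter> K" for t y
      proof -
        have "y \<in> ?L"
          using y YA(5) ZB(5) by blast
        then have "F t y \<in> U" "G t y \<in> V"
          using t by blast+
        then show ?thesis
          using UV by (auto simp: W_def)
      qed
      ultimately show ?thesis
        by (intro exI[of _ ?M] exI[of _ ?N] conjI ballI)
    qed
    then obtain M N where MN: "\<And>x. x \<in> K \<Longrightarrow> openin X (M x) \<and> x \<in> M x \<and> openin S (N x) \<and> s \<in> N x \<and>
        (\<forall>t \<in> N x. \<forall>y \<in> M x \<inter> K. \<phi> (F t y, G t y) \<in> O')"
      by metis
    have "\<forall>M' \<in> M ` K. openin X M'" "K \<subseteq> \<Union> (M ` K)"
      using MN by blast+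
    then obtain \<F> where "finite \<F>" "\<F> \<subseteq> M ` K" "K \<subseteq> \<Union> \<F>"
      using K unfolding compactin_def by meson
    then obtain I where I: "finite I" "I \<subseteq> K" "K \<subseteq> \<Union> (M ` I)"
      by (metis finite_subset_image)
    \<comment> \<open>Intersecting with \<open>topspace S\<close> matters when \<open>I\<close> is
      empty, where the indexed intersection is \<open>UNIV\<close>.\<close>
    let ?N = "(\<Inter>x \<in> I. N x) \<inter> topspace S"
    have "openin S ?N"
      using I MN by (intro openin_INT) auto
    moreover have "s \<in> ?N"
      using I(2) MN sS by blast
    moreover have "t \<in> ?P" if t: "t \<in> ?N" for t
    proof -
      have "\<phi> (F t y, G t y) \<in> O'" if y: "y \<in> K" for y
      proof -
        obtain x where x: "x \<in> I" "y \<in> M x"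
          using I(3) y by blast
        then show ?thesis
          using MN[of x] I(2) t y by blast
      qed
      then show ?thesis
        using t KX by auto
    qed
    ultimately show ?thesis
      by blast
  qed
  then show "openin S ?P"
    by (subst openin_subopen) blast
qed

section \<open>Splitting the function space along the retraction\<close>

theorem proposition14p1:
  fixes X :: "'a topology" and Y :: "'b topology" and e :: 'b
  assumes "rectifiable_space Y e"
    and "nonisolated_points X retract_of_space X"
  shows "Ck_space X Y homeomorphic_space
           prod_topology (Ck_space (subtopology X (nonisolated_points X)) Y) (Ck'_space X Y e)"
proof -
  define A where "A = nonisolated_points X"
  let ?XA = "subtopology X A"
  let ?C = "Ck_space X Y" and ?CA = "Ck_space ?XA Y" and ?C' = "Ck'_space X Y e"
  obtain r where AX: "A \<subseteq> topspace X" and r: "continuous_map X ?XA r" and ra: "\<And>x. x \<in> A \<Longrightarrow> r x = x"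
    using assms(2) unfolding retract_of_space_def A_def by blast
  have topA: "topspace ?XA = A"
    using AX by auto
  \<comment> \<open>Both readings of \<open>r\<close> are needed: as a self-map of \<open>X\<close>
    to precompose \<open>f\<close> in \<open>\<Phi>\<close>, and as a map onto \<open>?XA\<close> to
    precompose \<open>g\<close> in \<open>\<Psi>\<close>.\<close>
  have rX: "continuous_map X X r" and rA: "\<And>x. x \<in> topspace X \<Longrightarrow> r x \<in> A"
    using r topA by (auto simp: continuous_map_in_subtopology)
  note reg = rectifiable_imp_regular_space[OF assms(1)]
  obtain p q where p: "continuous_map (prod_topology Y Y) Y p"
    and q: "continuous_map (prod_topology Y Y) Y q"
    and qp: "\<forall>x \<in> topspace Y. \<forall>y \<in> topspace Y. q (x, p (x, y)) = y"
    and pq: "\<forall>x \<in> topspace Y. \<forall>y \<in> topspace Y. p (x, q (x, y)) = y"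
    and pe: "\<forall>x \<in> topspace Y. p (x, x) = e"
    and qe: "\<forall>x \<in> topspace Y. q (x, e) = x"
    using rectifiable_spaceE[OF assms(1)] .
  have topC': "topspace ?C' = {f \<in> continuous_maps X Y. f ` A \<subseteq> {e}}"
    by (auto simp: Ck'_space_def A_def)
  have val: "f x \<in> topspace Y" if "f \<in> continuous_maps Z Y" "x \<in> topspace Z"
    for f :: "'a \<Rightarrow> 'b" and Z x
    using continuous_mapsD(1)[OF that(1)] that(2) by (auto simp: continuous_map_def)
  define \<Phi> where "\<Phi> f = (restrict f A, \<lambda>x \<in> topspace X. p (f (r x), f x))" for f
  define \<Psi> where "\<Psi> gh = (\<lambda>x \<in> topspace X. q (fst gh (r x), snd gh x))" for gh
  \<comment> \<open>Restriction is precomposition with the inclusion of \<open>A\<close> into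
    \<open>X\<close>.\<close>
  have "continuous_map ?C ?CA (\<lambda>f. restrict f A)"
    using continuous_map_Ck_space_precompose[OF continuous_map_id[unfolded id_def],
        OF continuous_map_from_subtopology[OF continuous_map_id[unfolded id_def]], of X Y A]
    unfolding topA .
  moreover have "continuous_map ?C ?C' (\<lambda>f. \<lambda>x \<in> topspace X. p (f (r x), f x))"
    unfolding Ck'_space_def continuous_map_in_subtopology
  proof
    have id: "continuous_map ?C ?C (\<lambda>f. f)"
      using continuous_map_id[of ?C] by (simp add: id_def)
    \<comment> \<open>The inner restriction is the form in which the precomposition lemma delivers
      \<open>f\<close> composed with \<open>r\<close>; under the outer restriction it
      disappears.\<close>
    have "continuous_map ?C ?C (\<lambda>f. \<lambda>x \<in> topspace X. p ((\<lambda>x \<in> topspace X. f (r x)) x, f x))"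
      by (rule continuous_map_Ck_space_postcompose2[OF reg reg p
            continuous_map_Ck_space_precompose[OF id rX] id])
    then show cont: "continuous_map ?C ?C (\<lambda>f. \<lambda>x \<in> topspace X. p (f (r x), f x))"
      by (simp cong: restrict_cong)
    \<comment> \<open>On \<open>A\<close> the retraction is the identity, so the value there is
      \<open>p (f x, f x) = e\<close>.\<close>
    show "(\<lambda>f. \<lambda>x \<in> topspace X. p (f (r x), f x)) \<in> topspace ?C \<rightarrow>
        {f \<in> continuous_maps X Y. f ` nonisolated_points X \<subseteq> {e}}"
      using continuous_map_into_continuous_maps[OF cont] AX ra pe val
      by (auto simp flip: A_def simp: subset_iff)
  qed
  ultimately have \<Phi>: "continuous_map ?C (prod_topology ?CA ?C') \<Phi>"
    unfolding \<Phi>_def by (rule continuous_map_pairedI)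
  have "continuous_map (prod_topology ?CA ?C') ?C snd"
    using continuous_map_snd[of ?CA ?C'] unfolding Ck'_space_def continuous_map_in_subtopology by blast
  then have "continuous_map (prod_topology ?CA ?C') ?C
      (\<lambda>gh. \<lambda>x \<in> topspace X. q ((\<lambda>x \<in> topspace X. fst gh (r x)) x, snd gh x))"
    by (rule continuous_map_Ck_space_postcompose2[OF reg reg q
            continuous_map_Ck_space_precompose[OF continuous_map_fst r]])
  then have \<Psi>: "continuous_map (prod_topology ?CA ?C') ?C \<Psi>"
    unfolding \<Psi>_def by (simp cong: restrict_cong)
  have "\<Psi> (\<Phi> f) = f" if f: "f \<in> continuous_maps X Y" for f
  proof (rule extensionalityI)
    show "f \<in> extensional (topspace X)"
      using f by (rule continuous_mapsD)
    show "\<Psi> (\<Phi> f) \<in> extensional (topspace X)"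
      by (simp add: \<Psi>_def)
    \<comment> \<open>As \<open>r x\<close> lies in \<open>A\<close>, restricting \<open>f\<close>
      to \<open>A\<close> keeps the value \<open>f (r x)\<close>, and \<open>q (f (r x), _)\<close>
      undoes \<open>p (f (r x), _)\<close>.\<close>
    show "\<Psi> (\<Phi> f) x = f x" if "x \<in> topspace X" for x
      using that rA[OF that] AX val[OF f] qp by (auto simp: \<Psi>_def \<Phi>_def subset_iff)
  qed
  moreover have "\<Phi> (\<Psi> (g, h)) = (g, h)"
    if g: "g \<in> continuous_maps ?XA Y" and h: "h \<in> topspace ?C'" for g h
  proof -
    have hC: "h \<in> continuous_maps X Y" and he: "\<And>x. x \<in> A \<Longrightarrow> h x = e"
      using h unfolding topC' by auto
    have gY: "\<And>x. x \<in> A \<Longrightarrow> g x \<in> topspace Y"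
      using val[OF g] unfolding topA .
    \<comment> \<open>On \<open>A\<close> the value is \<open>q (g x, e) = g x\<close>, because
      \<open>r x = x\<close> and \<open>h x = e\<close>. This recovers \<open>g\<close>. Applied at
      \<open>r x\<close>, it also shows that \<open>p\<close> is later evaluated over the same base
      point \<open>g (r x)\<close> that \<open>q\<close> used, which recovers
      \<open>h\<close>.\<close>
    have onA: "\<Psi> (g, h) x = g x" if "x \<in> A" for x
      using that AX ra he qe gY by (auto simp: \<Psi>_def)
    have "restrict (\<Psi> (g, h)) A = g"
      using onA continuous_mapsD(2)[OF g] topA by (auto intro: extensionalityI[where A = A])
    moreover have "(\<lambda>x \<in> topspace X. p (\<Psi> (g, h) (r x), \<Psi> (g, h) x)) = h"
    proof (rule extensionalityI)
      show "h \<in> extensional (topspace X)"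
        using hC by (rule continuous_mapsD)
      show "(\<lambda>x \<in> topspace X. p (\<Psi> (g, h) (r x), \<Psi> (g, h) x)) x = h x" if "x \<in> topspace X" for x
        using that onA[OF rA[OF that]] pq gY rA val[OF hC] by (simp add: \<Psi>_def)
    qed simp
    ultimately show ?thesis
      by (simp add: \<Phi>_def)
  qed
  ultimately have "homeomorphic_maps ?C (prod_topology ?CA ?C') \<Phi> \<Psi>"
    using \<Phi> \<Psi> by (auto simp: homeomorphic_maps_def)
  then show ?thesis
    unfolding A_def homeomorphic_space_def by blast
qed

end
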